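(* Let $d$ be a degree sequence and let $\mathcal{P}(d)$ be the subgraph of the realization graph $\mathcal{G}(d)$ induced by the pseudoforests with degree sequence $d$. Then $\mathcal{P}(d)$ is connected; i.e., any two pseudoforests on $\{1,\dots,n\}$ with the same degree sequence can be transformed into one another by a sequence of 2-switches all of whose intermediate graphs are pseudoforests.
   Context: All graphs are finite and simple. A pseudoforest is a graph each of whose connected components is a tree or a unicyclic graph (connected with exactly one cycle). A 2-switch on $G$ is specified by four distinct vertices $a,b,c,d$ with $ab,cd\in E(G)$ and $ac,bd\notin E(G)$; it produces $G-ab-cd+ac+bd$. The realization graph $\mathcal{G}(d)$ has as vertices all graphs on $\{1,\dots,n\}$ with degree sequence $d$, adjacent when one is obtained from the other by a single 2-switch. *)

theory Defs
  imports "Graph_Theory.Graph_Theory"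
begin

text \<open>
  A finite simple graph is a \<^locale>\<open>pair_graph\<close>: a finite, loopless, symmetric digraph without
  parallel arcs, in which the undirected edge \<open>uv\<close> is the pair of arcs \<open>(u, v)\<close>, \<open>(v, u)\<close>.
  Because of the symmetry its strongly connected components \<open>sccs\<close> are its connected components
  (as induced subgraphs), and the out-degree of a vertex is its degree.
\<close>

text \<open>
  The cycles of an undirected graph, each given by its set of undirected edges, so that
  rotations and reversals of a closed walk are identified. The bound on the length excludes the
  directed 2-cycles \<open>u, v, u\<close> that run back and forth along one undirected edge. These 2-cycles
  are also why \<^const>\<open>tree\<close> cannot be used for trees below: in a symmetric digraph it admits
  no edge at all.
\<close>

definition cycles :: "('a, 'b) pre_digraph \<Rightarrow> 'a set set set" where
  "cycles G = {(\<lambda>e. {tail G e, head G e}) ` set p | p. pre_digraph.cycle G p \<and> 3 \<le> length p}"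

definition is_tree :: "('a, 'b) pre_digraph \<Rightarrow> bool" where
  "is_tree G \<longleftrightarrow> connected G \<and> cycles G = {}"

definition unicyclic :: "('a, 'b) pre_digraph \<Rightarrow> bool" where
  "unicyclic G \<longleftrightarrow> connected G \<and> (\<exists>!C. C \<in> cycles G)"

definition pseudoforest :: "'a pair_pre_digraph \<Rightarrow> bool" where
  "pseudoforest G \<longleftrightarrow> pair_graph G \<and>
     (\<forall>K \<in> pre_digraph.sccs (with_proj G). is_tree K \<or> unicyclic K)"

definition two_switch :: "'a pair_pre_digraph \<Rightarrow> 'a pair_pre_digraph \<Rightarrow> bool" where
  "two_switch G H \<longleftrightarrow> (\<exists>a b c d. distinct [a, b, c, d] \<and>
     (a, b) \<in> parcs G \<and> (c, d) \<in> parcs G \<and> (a, c) \<notin> parcs G \<and> (b, d) \<notin> parcs G \<and>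
     H = \<lparr> pverts = pverts G,
           parcs = (parcs G - {(a, b), (b, a), (c, d), (d, c)})
                     \<union> {(a, c), (c, a), (b, d), (d, b)} \<rparr>)"

text \<open>
  A sequence \<open>d\<^sub>1, \<dots>, d\<^sub>n\<close> is a function \<open>d\<close> of which only the values on \<open>{1..n}\<close> matter.
\<close>

definition realizations :: "nat \<Rightarrow> (nat \<Rightarrow> nat) \<Rightarrow> nat pair_pre_digraph set" where
  "realizations n d =
     {G. pair_graph G \<and> pverts G = {1..n} \<and> (\<forall>v \<in> {1..n}. out_degree (with_proj G) v = d v)}"

definition degree_sequence :: "nat \<Rightarrow> (nat \<Rightarrow> nat) \<Rightarrow> bool" where
  "degree_sequence n d \<longleftrightarrow> realizations n d \<noteq> {}"

definition realization_graph :: "nat \<Rightarrow> (nat \<Rightarrow> nat) \<Rightarrow> nat pair_pre_digraph pair_pre_digraph" where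
  "realization_graph n d =
     \<lparr> pverts = realizations n d,
       parcs = {(G, H). G \<in> realizations n d \<and> H \<in> realizations n d \<and>
                        (two_switch G H \<or> two_switch H G)} \<rparr>"

text \<open>
  It may have no vertices, in which case \<^const>\<open>connected\<close>, which demands a vertex, is false.
\<close>

definition pseudoforest_graph ::
  "nat \<Rightarrow> (nat \<Rightarrow> nat) \<Rightarrow>
     (nat pair_pre_digraph, nat pair_pre_digraph \<times> nat pair_pre_digraph) pre_digraph" where
  "pseudoforest_graph n d =
     with_proj (realization_graph n d) \<restriction> {G \<in> realizations n d. pseudoforest G}"

end

theory Submission
  imports Defs
begin

text \<open>
  A graph is a pseudoforest iff every edge can be assigned to one of its endpoints such that no
  vertex receives two edges, i.e. iff some \<open>f\<close> satisfies \<open>f x = y\<close> or \<open>f y = x\<close> for every edge \<open>xy\<close>.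
  If all degrees are at most 2, every realization is a pseudoforest and the connectedness of the
  whole realization graph suffices. Otherwise fix a vertex \<open>w\<close> of degree at least 3; as there are
  at most as many edges as vertices, there is a leaf \<open>v\<close>. In either pseudoforest one 2-switch makes
  \<open>v\<close> a neighbour of \<open>w\<close>. Deleting \<open>v\<close> leaves two smaller pseudoforests with equal degrees, and the
  switches that induction provides for them remain valid with \<open>v\<close> attached to \<open>w\<close> again.
\<close>

section \<open>Pseudoforests and orientations\<close>

text \<open>
  A cycle of length \<open>k\<close> is given by the \<open>k\<close>-periodic sequence \<open>g\<close> of its vertices, so that indices
  need no reduction modulo \<open>k\<close>.
\<close>

definition cycle_in :: "'a rel \<Rightarrow> nat \<Rightarrow> (nat \<Rightarrow> 'a) \<Rightarrow> bool" where
  "cycle_in R k g \<longleftrightarrow>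
     3 \<le> k \<and> inj_on g {..<k} \<and> (\<forall>i. g (i + k) = g i) \<and> (\<forall>i. (g i, g (Suc i)) \<in> R)"

definition cycle_edges :: "(nat \<Rightarrow> 'a) \<Rightarrow> 'a set set" where
  "cycle_edges g = range (\<lambda>i. {g i, g (Suc i)})"

definition one_cycle :: "'a rel \<Rightarrow> bool" where
  "one_cycle R \<longleftrightarrow> (\<forall>k g l h. cycle_in R k g \<longrightarrow> cycle_in R l h \<longrightarrow> (g 0, h 0) \<in> R\<^sup>* \<longrightarrow>
     cycle_edges g = cycle_edges h)"

text \<open>Vertices without a chosen edge have a junk value that is not a neighbour.\<close>

definition orients :: "('a \<Rightarrow> 'a) \<Rightarrow> 'a rel \<Rightarrow> bool" where
  "orients f R \<longleftrightarrow> (\<forall>(x, y) \<in> R. f x = y \<or> f y = x)"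

lemma orientsD: "orients f R \<Longrightarrow> (x, y) \<in> R \<Longrightarrow> f x = y \<or> f y = x"
  by (auto simp: orients_def)

section \<open>Index arithmetic on periodic cycles\<close>

lemma cycle_in_mult:
  assumes "cycle_in R k g"
  shows "g (i + j * k) = g i"
proof (induction j)
  case (Suc j)
  have "g (i + Suc j * k) = g ((i + j * k) + k)" by (simp add: algebra_simps)
  also have "\<dots> = g (i + j * k)" using assms unfolding cycle_in_def by blast
  finally show ?case using Suc by simp
qed simp

lemma cycle_in_mod:
  assumes "cycle_in R k g"
  shows "g (i mod k) = g i"
  using cycle_in_mult[OF assms, of "i mod k" "i div k"] by (simp add: mult.commute)

lemma cycle_in_eq_iff:
  assumes "cycle_in R k g"
  shows "g i = g j \<longleftrightarrow> i mod k = j mod k"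
proof
  assume "g i = g j"
  hence "g (i mod k) = g (j mod k)" by (simp add: cycle_in_mod[OF assms])
  moreover have "i mod k < k" "j mod k < k" using assms by (auto simp: cycle_in_def)
  ultimately show "i mod k = j mod k"
    using assms by (auto simp: cycle_in_def inj_on_def)
next
  assume "i mod k = j mod k"
  thus "g i = g j" using cycle_in_mod[OF assms] by metis
qed

text \<open>The period is at least 3 and so does not divide 2. This excludes backtracking along an
  edge.\<close>

lemma cycle_in_two_steps:
  assumes "cycle_in R k g"
  shows "g (Suc (Suc i)) \<noteq> g i"
proof
  assume "g (Suc (Suc i)) = g i"
  hence eq: "(i + 2) mod k = i mod k" using cycle_in_eq_iff[OF assms, of "Suc (Suc i)" i] by simp
  have "3 \<le> k" using assms by (simp add: cycle_in_def)
  have "k dvd 2" using eq mod_eq_dvd_iff_nat[of i "i + 2" k] by simp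
  with \<open>3 \<le> k\<close> show False by (auto dest: dvd_imp_le)
qed

text \<open>Periodicity permits an arbitrarily large index, so that predecessors and differences of
  indices are not truncated at 0.\<close>

lemma cycle_in_vertex_shift:
  assumes "cycle_in R k g"
  obtains j where "g i = g j" "m \<le> j"
proof
  show "g i = g (i + m * k)" using cycle_in_mult[OF assms] by simp
  have "1 \<le> k" using assms by (simp add: cycle_in_def)
  thus "m \<le> i + m * k" by (simp add: trans_le_add2)
qed

lemma cycle_in_connected:
  assumes "cycle_in R k g"
  shows "(g i, g (i + j)) \<in> R\<^sup>*"
proof (induction j)
  case (Suc j)
  have "(g (i + j), g (i + Suc j)) \<in> R" using assms by (simp add: cycle_in_def)
  with Suc show ?case by (rule rtrancl_into_rtrancl)
qed simp

section \<open>An orientation admits at most one cycle per component\<close>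

text \<open>If one edge of the cycle is assigned to its second end, that end has spent its value of
  \<open>f\<close>, so the next edge is assigned to its second end too, and so on all the way round.
  Hence \<open>f\<close> runs along the whole cycle in one direction, and the cycle is the orbit of
  each of its vertices.\<close>

lemma oriented_cycle_edges:
  assumes f: "orients f R" and g: "cycle_in R k g"
  shows "f (g i) \<in> range g"
    and "cycle_edges g = {{y, f y} | y. \<exists>j. y = (f ^^ j) (g i)}"
proof -
  have step: "f (g i) = g (Suc i) \<or> f (g (Suc i)) = g i" for i
    using g orientsD[OF f] by (simp add: cycle_in_def)
  have *: "f (g i) \<in> range g \<and> cycle_edges g = {{y, f y} | y. \<exists>j. y = (f ^^ j) (g i)}"
  proof (cases "\<forall>i. f (g i) = g (Suc i)")
    case True
    have orb: "(f ^^ j) (g i) = g (i + j)" for j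
      by (induction j) (auto simp: True)
    have "\<exists>j. g m = (f ^^ j) (g i)" for m
    proof -
      obtain n where "g m = g n" "i \<le> n" using cycle_in_vertex_shift[OF g] by blast
      thus ?thesis using orb[of "n - i"] by (intro exI[of _ "n - i"]) simp
    qed
    hence "range g = {y. \<exists>j. y = (f ^^ j) (g i)}" using orb by auto
    moreover have "cycle_edges g = {{y, f y} | y. y \<in> range g}"
      by (auto simp: cycle_edges_def True)
    ultimately show ?thesis using True by auto
  next
    case False
    then obtain i0 where i0: "f (g i0) \<noteq> g (Suc i0)" by blast
    have backw0: "f (g (Suc (i0 + j))) = g (i0 + j)" for j
    proof (induction j)
      case 0
      thus ?case using step[of i0] i0 by simp
    next
      case (Suc j)
      hence "f (g (Suc (i0 + j))) \<noteq> g (Suc (Suc (i0 + j)))"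
        using cycle_in_two_steps[OF g, of "i0 + j"] by simp
      thus ?case using step[of "Suc (i0 + j)"] by simp
    qed
    \<comment> \<open>Adding a multiple of the period carries this from the indices beyond
      \<open>i0\<close> to all indices.\<close>
    have backw: "f (g (Suc i)) = g i" for i
    proof -
      have "1 \<le> k" using g by (simp add: cycle_in_def)
      hence "i0 \<le> i + i0 * k" by (simp add: trans_le_add2)
      hence "f (g (Suc (i + i0 * k))) = g (i + i0 * k)"
        using backw0[of "i + i0 * k - i0"] by simp
      thus ?thesis using cycle_in_mult[OF g, of i i0] cycle_in_mult[OF g, of "Suc i" i0] by simp
    qed
    have orb: "(f ^^ j) (g (m + j)) = g m" for j m
      by (induction j) (auto simp: backw funpow_swap1)
    have closed: "f (g m) \<in> range g" for m
    proof -
      obtain n where "g m = g n" "1 \<le> n" using cycle_in_vertex_shift[OF g] by blast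
      thus ?thesis using backw[of "n - 1"] by simp
    qed
    have "(f ^^ j) (g i) \<in> range g" for j
      by (induction j) (use closed in \<open>auto\<close>)
    moreover have "\<exists>j. g m = (f ^^ j) (g i)" for m
    proof -
      obtain n where "g i = g n" "m \<le> n" using cycle_in_vertex_shift[OF g] by blast
      thus ?thesis using orb[of "n - m" m] by (intro exI[of _ "n - m"]) simp
    qed
    ultimately have "range g = {y. \<exists>j. y = (f ^^ j) (g i)}" by auto
    moreover have "cycle_edges g = {{y, f y} | y. y \<in> range g}"
    proof -
      have "cycle_edges g \<subseteq> {{y, f y} | y. y \<in> range g}"
      proof
        fix e assume "e \<in> cycle_edges g"
        then obtain i where "e = {g i, g (Suc i)}" by (auto simp: cycle_edges_def)
        hence "e = {g (Suc i), f (g (Suc i))}" by (auto simp: backw)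
        thus "e \<in> {{y, f y} | y. y \<in> range g}" by blast
      qed
      moreover have "{g m, f (g m)} \<in> cycle_edges g" for m
      proof -
        obtain n where n: "g m = g n" "1 \<le> n" using cycle_in_vertex_shift[OF g] by blast
        have "{g m, f (g m)} = {g (n - 1), g (Suc (n - 1))}"
          using n backw[of "n - 1"] by auto
        thus ?thesis by (auto simp: cycle_edges_def)
      qed
      ultimately show ?thesis by blast
    qed
    ultimately show ?thesis using closed by auto
  qed
  show "f (g i) \<in> range g" using * by simp
  show "cycle_edges g = {{y, f y} | y. \<exists>j. y = (f ^^ j) (g i)}" using * by simp
qed

text \<open>Each edge is a step of \<open>f\<close> in one of its two directions, so extending the
  path by an edge lengthens one of the two iterations by one.\<close>

lemma oriented_orbits_meet:
  assumes "orients f R" "(x, y) \<in> R\<^sup>*"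
  shows "\<exists>i j. (f ^^ i) x = (f ^^ j) y"
  using assms(2)
proof (induction rule: rtrancl_induct)
  case base
  show ?case by blast
next
  case (step y z)
  then obtain i j where ij: "(f ^^ i) x = (f ^^ j) y" by blast
  show ?case
  proof (cases "f y = z")
    case True
    hence "(f ^^ Suc i) x = (f ^^ j) z" using ij by (simp add: funpow_swap1)
    thus ?thesis by blast
  next
    case False
    hence "f z = y" using orientsD[OF assms(1) step(2)] by blast
    hence "(f ^^ i) x = (f ^^ Suc j) z" using ij by (simp add: funpow_swap1)
    thus ?thesis by blast
  qed
qed

text \<open>A common iterate of \<open>g 0\<close> and \<open>h 0\<close> lies on both cycles, since
  \<open>f\<close> maps each cycle into itself, and both cycles are the orbit of that
  vertex.\<close>

lemma orients_imp_one_cycle: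
  assumes f: "orients f R"
  shows "one_cycle R"
  unfolding one_cycle_def
proof (intro allI impI)
  fix k g l h assume g: "cycle_in R k g" and h: "cycle_in R l h" and gh: "(g 0, h 0) \<in> R\<^sup>*"
  obtain i j where ij: "(f ^^ i) (g 0) = (f ^^ j) (h 0)"
    using oriented_orbits_meet[OF f gh] by blast
  have "(f ^^ i) (g 0) \<in> range g" for i
    by (induction i) (use oriented_cycle_edges(1)[OF f g] in auto)
  then obtain m where m: "(f ^^ i) (g 0) = g m" by blast
  have "(f ^^ i) (h 0) \<in> range h" for i
    by (induction i) (use oriented_cycle_edges(1)[OF f h] in auto)
  then obtain n where n: "(f ^^ j) (h 0) = h n" by blast
  show "cycle_edges g = cycle_edges h"
    using oriented_cycle_edges(2)[OF f g, of m] oriented_cycle_edges(2)[OF f h, of n] m n ij by simp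
qed

section \<open>Graphs of maximum degree at most 2\<close>

text \<open>A cycle takes up both neighbours of each of its vertices, so no edge leaves it and it
  consists of all edges of its component.\<close>

lemma degree_le_2_imp_one_cycle:
  assumes sym: "sym R" and fin: "finite R" and deg: "\<And>x. card (R `` {x}) \<le> 2"
  shows "one_cycle R"
proof -
  have all: "cycle_edges g = {{x, y} | x y. (x, y) \<in> R \<and> (g 0, x) \<in> R\<^sup>*}"
    if g: "cycle_in R k g" for k g
  proof -
    \<comment> \<open>The predecessor and the successor of \<open>x\<close> on the cycle are
      distinct and therefore fill its neighbourhood.\<close>
    have nb: "\<exists>i. x = g i \<and> y = g (Suc i) \<or> x = g (Suc i) \<and> y = g i"
      if x: "x \<in> range g" and xy: "(x, y) \<in> R" for x y
    proof -
      obtain m where "x = g m" using x by blast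
      then obtain n where n: "x = g n" "1 \<le> n" using cycle_in_vertex_shift[OF g] by metis
      have "g (Suc n) \<noteq> g (n - 1)" using cycle_in_two_steps[OF g, of "n - 1"] n by simp
      moreover have "(g n, g (Suc n)) \<in> R" "(g (n - 1), g (Suc (n - 1))) \<in> R"
        using g unfolding cycle_in_def by blast+
      hence sub: "{g (Suc n), g (n - 1)} \<subseteq> R `` {x}" using n sym by (auto dest: symD)
      moreover have "finite (R `` {x})" using fin by (simp add: finite_Image)
      ultimately have "{g (Suc n), g (n - 1)} = R `` {x}"
        using deg[of x] by (intro card_seteq) auto
      hence "y = g (Suc n) \<or> y = g (n - 1)" using xy by auto
      moreover have "Suc (n - 1) = n" using n by simp
      ultimately show ?thesis using n by metis
    qed
    have comp: "x \<in> range g" if "(g 0, x) \<in> R\<^sup>*" for x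
      using that by (induction rule: rtrancl_induct) (use nb in blast)+
    show ?thesis
    proof
      show "cycle_edges g \<subseteq> {{x, y} | x y. (x, y) \<in> R \<and> (g 0, x) \<in> R\<^sup>*}"
      proof
        fix e assume "e \<in> cycle_edges g"
        then obtain i where "e = {g i, g (Suc i)}" by (auto simp: cycle_edges_def)
        moreover have "(g i, g (Suc i)) \<in> R" using g by (simp add: cycle_in_def)
        moreover have "(g 0, g i) \<in> R\<^sup>*" using cycle_in_connected[OF g, of 0 i] by simp
        ultimately show "e \<in> {{x, y} | x y. (x, y) \<in> R \<and> (g 0, x) \<in> R\<^sup>*}" by blast
      qed
      show "{{x, y} | x y. (x, y) \<in> R \<and> (g 0, x) \<in> R\<^sup>*} \<subseteq> cycle_edges g"
      proof
        fix e assume "e \<in> {{x, y} | x y. (x, y) \<in> R \<and> (g 0, x) \<in> R\<^sup>*}"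
        then obtain x y where "e = {x, y}" "(x, y) \<in> R" "(g 0, x) \<in> R\<^sup>*" by blast
        moreover then obtain i where "x = g i \<and> y = g (Suc i) \<or> x = g (Suc i) \<and> y = g i"
          using nb comp by blast
        ultimately show "e \<in> cycle_edges g" by (auto simp: cycle_edges_def)
      qed
    qed
  qed
  show ?thesis
    unfolding one_cycle_def
  proof (intro allI impI)
    fix k g l h assume g: "cycle_in R k g" and h: "cycle_in R l h" and gh: "(g 0, h 0) \<in> R\<^sup>*"
    have "(h 0, g 0) \<in> R\<^sup>*" using gh sym by (metis sym_rtrancl symD)
    hence "(g 0, x) \<in> R\<^sup>* \<longleftrightarrow> (h 0, x) \<in> R\<^sup>*" for x using gh by (blast intro: rtrancl_trans)
    thus "cycle_edges g = cycle_edges h" using all[OF g] all[OF h] by simp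
  qed
qed

section \<open>Construction of an orientation from the uniqueness of cycles\<close>

text \<open>A shortest path works: cutting out the segment between two occurrences of a vertex would
  shorten it.\<close>

lemma rtrancl_imp_injective_path:
  assumes "(x, y) \<in> S\<^sup>*"
  obtains n h where "h 0 = x" "h n = y" "inj_on h {..n}" "\<And>i. i < n \<Longrightarrow> (h i, h (Suc i)) \<in> S"
proof -
  define n where "n = (LEAST n. (x, y) \<in> S ^^ n)"
  obtain m where "(x, y) \<in> S ^^ m" using assms rtrancl_imp_relpow by blast
  hence n: "(x, y) \<in> S ^^ n" unfolding n_def by (rule LeastI)
  have least: "n \<le> m" if "(x, y) \<in> S ^^ m" for m
    unfolding n_def using that by (rule Least_le)
  obtain h where h: "h 0 = x" "h n = y" "\<And>i. i < n \<Longrightarrow> (h i, h (Suc i)) \<in> S"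
    using n unfolding relpow_fun_conv by blast
  have seg: "(h i, h (i + j)) \<in> S ^^ j" if "i + j \<le> n" for i j
    unfolding relpow_fun_conv using that h(3) by (intro exI[of _ "\<lambda>m. h (i + m)"]) auto
  have "h i \<noteq> h j" if "i < j" "j \<le> n" for i j
  proof
    assume eq: "h i = h j"
    have "(x, h i) \<in> S ^^ i" using seg[of 0 i] that h by simp
    moreover have "(h i, y) \<in> S ^^ (n - j)" using seg[of j "n - j"] that h eq by simp
    ultimately have "(x, y) \<in> S ^^ (i + (n - j))" by (auto simp: relpow_add)
    from least[OF this] that show False by simp
  qed
  hence "inj_on h {..n}" by (intro linorder_inj_onI) auto
  with h show ?thesis using that by blast
qed

text \<open>The edge \<open>uv\<close> closes a path in \<open>S\<close> from \<open>v\<close> to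
  \<open>u\<close>. As this path is neither trivial nor the single arc \<open>(v, u)\<close>, the
  cycle has at least three vertices.\<close>

lemma cycle_through_edge:
  assumes uv: "(u, v) \<in> R" "u \<noteq> v" and path: "(v, u) \<in> S\<^sup>*" and "S \<subseteq> R" and vu: "(v, u) \<notin> S"
  obtains k g where "cycle_in R k g" "g 0 = v" "{u, v} \<in> cycle_edges g"
    "cycle_edges g \<subseteq> insert {u, v} {{x, y} | x y. (x, y) \<in> S}"
proof -
  obtain n h where h: "h 0 = v" "h n = u" "inj_on h {..n}" "\<And>i. i < n \<Longrightarrow> (h i, h (Suc i)) \<in> S"
    using rtrancl_imp_injective_path[OF path] by metis
  have "n \<noteq> 0" using h uv by (metis)
  moreover have "n \<noteq> 1" using h vu by (metis One_nat_def zero_less_one)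
  ultimately have n: "2 \<le> n" by simp
  \<comment> \<open>The path has \<open>n + 1\<close> vertices; the wrap from index \<open>n\<close>
    to index 0 is the closing edge.\<close>
  define g where "g i = h (i mod Suc n)" for i
  have step: "g i = u \<and> g (Suc i) = v \<or> (g i, g (Suc i)) \<in> S" for i
  proof (cases "i mod Suc n = n")
    case True
    thus ?thesis by (simp add: g_def h mod_Suc)
  next
    case False
    hence "i mod Suc n < n" using mod_less_divisor[of "Suc n" i] by linarith
    thus ?thesis using h(4)[of "i mod Suc n"] by (simp add: g_def mod_Suc)
  qed
  show ?thesis
  proof
    show "cycle_in R (Suc n) g"
      unfolding cycle_in_def
    proof (intro conjI allI)
      show "inj_on g {..<Suc n}" using h(3) by (auto simp: inj_on_def g_def)
      show "g (i + Suc n) = g i" for i unfolding g_def by (metis mod_add_self2)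
      show "(g i, g (Suc i)) \<in> R" for i using step[of i] uv \<open>S \<subseteq> R\<close> by auto
    qed (use n in simp)
    show "g 0 = v" by (simp add: g_def h)
    have "{u, v} = {g n, g (Suc n)}" by (simp add: g_def h)
    thus "{u, v} \<in> cycle_edges g" unfolding cycle_edges_def by blast
    show "cycle_edges g \<subseteq> insert {u, v} {{x, y} | x y. (x, y) \<in> S}"
    proof
      fix e assume "e \<in> cycle_edges g"
      then obtain i where "e = {g i, g (Suc i)}" by (auto simp: cycle_edges_def)
      thus "e \<in> insert {u, v} {{x, y} | x y. (x, y) \<in> S}" using step[of i] by blast
    qed
  qed
qed

text \<open>
  Here \<open>f\<close> is the parent map of a spanning tree with root \<open>r\<close>; an edge \<open>xy\<close> outside the tree is not a
  bridge, since the tree paths from \<open>x\<close> and \<open>y\<close> to \<open>r\<close> avoid it.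
\<close>

lemma spanning_tree_function:
  assumes "sym T"
  obtains f where "f r = r"
    "\<And>x y. (x, y) \<in> T \<Longrightarrow> (x, r) \<in> T\<^sup>* \<Longrightarrow>
       f x = y \<or> f y = x \<or> (x, y) \<in> (T - {(x, y), (y, x)})\<^sup>*"
proof -
  \<comment> \<open>This is the distance to the root; a parent is a neighbour at smaller
    distance.\<close>
  define d where "d x = (LEAST n. (x, r) \<in> T ^^ n)" for x
  have "\<exists>y. (x, y) \<in> T \<and> (y, r) \<in> T\<^sup>* \<and> d y < d x" if xr: "(x, r) \<in> T\<^sup>*" "x \<noteq> r" for x
  proof -
    obtain m where "(x, r) \<in> T ^^ m" using xr rtrancl_imp_relpow by blast
    hence dx: "(x, r) \<in> T ^^ d x" unfolding d_def by (rule LeastI)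
    with xr(2) obtain n where n: "d x = Suc n" by (cases "d x") auto
    then obtain y where y: "(x, y) \<in> T" "(y, r) \<in> T ^^ n" using dx relpow_Suc_D2 by metis
    have "d y \<le> n" unfolding d_def using y(2) by (rule Least_le)
    thus ?thesis using y n by (auto intro: relpow_imp_rtrancl)
  qed
  then obtain p where p: "\<And>x. (x, r) \<in> T\<^sup>* \<Longrightarrow> x \<noteq> r \<Longrightarrow>
      (x, p x) \<in> T \<and> (p x, r) \<in> T\<^sup>* \<and> d (p x) < d x" by metis
  define f where "f = p(r := r)"
  have to_root: "(x, r) \<in> (T - {(a, b), (b, a)})\<^sup>*"
    if "(x, r) \<in> T\<^sup>*" "f a \<noteq> b" "f b \<noteq> a" for x a b
    using that(1)
  proof (induction "d x" arbitrary: x rule: less_induct)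
    case less
    show ?case
    proof (cases "x = r")
      case False
      hence x: "(x, p x) \<in> T" "(p x, r) \<in> T\<^sup>*" "d (p x) < d x" using p less.prems by auto
      have "(x, p x) \<in> T - {(a, b), (b, a)}" using x(1) that(2,3) False by (auto simp: f_def)
      thus ?thesis using less.hyps[OF x(3) x(2)] by (rule converse_rtrancl_into_rtrancl)
    qed simp
  qed
  show ?thesis
  proof
    show "f r = r" by (simp add: f_def)
    fix x y assume xy: "(x, y) \<in> T" "(x, r) \<in> T\<^sup>*"
    let ?T = "T - {(x, y), (y, x)}"
    show "f x = y \<or> f y = x \<or> (x, y) \<in> ?T\<^sup>*"
    proof (rule ccontr)
      assume neg: "\<not> ?thesis"
      have "(y, r) \<in> T\<^sup>*" using xy assms by (meson converse_rtrancl_into_rtrancl symD)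
      hence "(x, r) \<in> ?T\<^sup>*" "(y, r) \<in> ?T\<^sup>*" using to_root xy neg by blast+
      moreover have "sym ?T" using assms by (auto simp: sym_def)
      ultimately have "(x, y) \<in> ?T\<^sup>*" by (meson rtrancl_trans sym_rtrancl symD)
      thus False using neg by simp
    qed
  qed
qed

text \<open>If all edges of the component are bridges, the parent map of a spanning tree orients it.
  Otherwise one edge \<open>rs\<close> that is not a bridge is removed and a spanning tree of the
  rest is rooted at \<open>r\<close>. By uniqueness of the cycle the rest has only bridges, and
  \<open>rs\<close> is assigned to \<open>r\<close>.\<close>

lemma one_cycle_component_orientation:
  assumes sym: "sym R" and irr: "irrefl R" and one: "one_cycle R"
  shows "\<exists>f. \<forall>x y. (x, y) \<in> R \<longrightarrow> (x, v) \<in> R\<^sup>* \<longrightarrow> f x = y \<or> f y = x"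
proof (cases "\<exists>r s. (r, s) \<in> R \<and> (r, v) \<in> R\<^sup>* \<and> (r, s) \<in> (R - {(r, s), (s, r)})\<^sup>*")
  case False
  obtain f where "\<And>x y. (x, y) \<in> R \<Longrightarrow> (x, v) \<in> R\<^sup>* \<Longrightarrow>
       f x = y \<or> f y = x \<or> (x, y) \<in> (R - {(x, y), (y, x)})\<^sup>*"
    using spanning_tree_function[OF sym] by metis
  with False show ?thesis by blast
next
  case True
  then obtain r s where rs: "(r, s) \<in> R" "(r, v) \<in> R\<^sup>*" "(r, s) \<in> (R - {(r, s), (s, r)})\<^sup>*" by blast
  define T where "T = R - {(r, s), (s, r)}"
  have symT: "sym T" using sym by (auto simp: T_def sym_def)
  have sr: "(s, r) \<in> R" "(r, s) \<in> T\<^sup>*" "(s, r) \<in> T\<^sup>*" "r \<noteq> s"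
    using rs sym symT irr by (auto simp: T_def irrefl_def dest: symD[OF sym_rtrancl] symD)
  \<comment> \<open>Removing an edge that is not a bridge keeps the component connected.\<close>
  have RT: "R\<^sup>* \<subseteq> T\<^sup>*"
  proof (rule rtrancl_subset_rtrancl, rule subsetI)
    fix e assume "e \<in> R"
    thus "e \<in> T\<^sup>*" using sr by (cases "e \<in> T") (auto simp: T_def)
  qed
  obtain f where f: "f r = r" "\<And>x y. (x, y) \<in> T \<Longrightarrow> (x, r) \<in> T\<^sup>* \<Longrightarrow>
       f x = y \<or> f y = x \<or> (x, y) \<in> (T - {(x, y), (y, x)})\<^sup>*"
    using spanning_tree_function[OF symT] by metis
  obtain k g where g: "cycle_in R k g" "g 0 = r" "{s, r} \<in> cycle_edges g"
  proof (rule cycle_through_edge[of s r R T])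
    show "T \<subseteq> R" "(r, s) \<notin> T" by (auto simp: T_def)
  qed (use sr in auto)
  \<comment> \<open>The root has no parent, \<open>f r = r\<close> being a junk value, so it is free
    to receive the edge \<open>rs\<close>.\<close>
  have "(f(r := s)) x = y \<or> (f(r := s)) y = x" if xy: "(x, y) \<in> R" "(x, v) \<in> R\<^sup>*" for x y
  proof (cases "(x, y) \<in> T")
    case False
    thus ?thesis using xy by (auto simp: T_def)
  next
    case True
    have xr: "(x, r) \<in> R\<^sup>*" using xy rs sym by (meson rtrancl_trans sym_rtrancl symD)
    \<comment> \<open>Otherwise \<open>xy\<close> would lie on a cycle within \<open>T\<close>,
      which avoids \<open>rs\<close>, whereas the cycle \<open>g\<close> of the same component
      contains \<open>rs\<close>.\<close>
    have "(x, y) \<notin> (T - {(x, y), (y, x)})\<^sup>*"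
    proof
      let ?T = "T - {(x, y), (y, x)}"
      assume path: "(x, y) \<in> ?T\<^sup>*"
      obtain l h where h: "cycle_in R l h" "h 0 = x"
        "cycle_edges h \<subseteq> insert {y, x} {{a, b} | a b. (a, b) \<in> ?T}"
      proof (rule cycle_through_edge[OF _ _ path])
        show "(y, x) \<in> R" using xy sym by (auto dest: symD)
        show "y \<noteq> x" using xy irr by (auto simp: irrefl_def)
        show "?T \<subseteq> R" "(x, y) \<notin> ?T" by (auto simp: T_def)
      qed auto
      have "{s, r} \<notin> cycle_edges h"
      proof
        assume "{s, r} \<in> cycle_edges h"
        hence "{s, r} = {y, x} \<or> (\<exists>a b. {s, r} = {a, b} \<and> (a, b) \<in> T)" using h(3) by blast
        thus False using True symT by (auto simp: T_def doubleton_eq_iff)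
      qed
      moreover have "cycle_edges h = cycle_edges g"
        using one h g xr unfolding one_cycle_def by metis
      ultimately show False using g by simp
    qed
    hence "f x = y \<or> f y = x" using f(2)[OF True] xr RT by blast
    moreover have "x \<noteq> y" using xy irr by (auto simp: irrefl_def)
    ultimately show ?thesis using f(1) by auto
  qed
  thus ?thesis by blast
qed

text \<open>The orientations of the components are glued: \<open>F\<close> picks one for each
  component, and each vertex consults the one of its own component.\<close>

lemma one_cycle_imp_orients:
  assumes sym: "sym R" and irr: "irrefl R" and one: "one_cycle R"
  obtains f where "orients f R"
proof -
  let ?C = "\<lambda>v. R\<^sup>* `` {v}"
  have "\<exists>f. \<forall>x y. (x, y) \<in> R \<longrightarrow> ?C x = C \<longrightarrow> f x = y \<or> f y = x" for C
  proof (cases "\<exists>v. C = ?C v")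
    case True
    then obtain v where v: "C = ?C v" by blast
    obtain f where "\<forall>x y. (x, y) \<in> R \<longrightarrow> (x, v) \<in> R\<^sup>* \<longrightarrow> f x = y \<or> f y = x"
      using one_cycle_component_orientation[OF assms] by blast
    thus ?thesis using v by blast
  qed auto
  then obtain F where F: "\<And>C x y. (x, y) \<in> R \<Longrightarrow> ?C x = C \<Longrightarrow> F C x = y \<or> F C y = x" by metis
  have "?C x = ?C y" if "(x, y) \<in> R" for x y
    using that sym by (auto dest: symD intro: converse_rtrancl_into_rtrancl)
  hence "orients (\<lambda>x. F (?C x) x) R" unfolding orients_def using F by fastforce
  thus ?thesis by (rule that)
qed

section \<open>Switches on edge relations\<close>

definition simple :: "'a rel \<Rightarrow> bool" where
  "simple R \<longleftrightarrow> finite R \<and> sym R \<and> irrefl R"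

definition switch :: "'a rel \<Rightarrow> 'a rel \<Rightarrow> bool" where
  "switch R S \<longleftrightarrow> (\<exists>a b c d. distinct [a, b, c, d] \<and>
     (a, b) \<in> R \<and> (c, d) \<in> R \<and> (a, c) \<notin> R \<and> (b, d) \<notin> R \<and>
     S = (R - {(a, b), (b, a), (c, d), (d, c)}) \<union> {(a, c), (c, a), (b, d), (d, b)})"

definition steps :: "('a rel \<Rightarrow> bool) \<Rightarrow> 'a rel \<Rightarrow> 'a rel \<Rightarrow> bool" where
  "steps P = (\<lambda>R S. switch R S \<and> P S)\<^sup>*\<^sup>*"

lemma simpleD:
  assumes "simple R"
  shows "finite R" "sym R" "(x, y) \<in> R \<Longrightarrow> (y, x) \<in> R" "(x, x) \<notin> R" "finite (R `` A)"
  using assms by (auto simp: simple_def irrefl_def finite_Image dest: symD)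

lemma simple_switch:
  assumes "simple R" "switch R S"
  shows "simple S"
  using assms unfolding simple_def switch_def sym_def irrefl_def
  by (elim exE conjE) (simp, blast)

text \<open>The switch back uses the same four vertices with \<open>b\<close> and \<open>c\<close>
  exchanged.\<close>

lemma switch_sym:
  assumes R: "simple R" and "switch R S"
  shows "switch S R"
proof -
  obtain a b c d where d: "distinct [a, b, c, d]"
    and e: "(a, b) \<in> R" "(c, d) \<in> R" "(a, c) \<notin> R" "(b, d) \<notin> R"
    and S: "S = (R - {(a, b), (b, a), (c, d), (d, c)}) \<union> {(a, c), (c, a), (b, d), (d, b)}"
    using assms(2) unfolding switch_def by blast
  have e': "(b, a) \<in> R" "(d, c) \<in> R" "(c, a) \<notin> R" "(d, b) \<notin> R"
    using e simpleD(3)[OF R] by blast+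
  have "R = (S - {(a, c), (c, a), (b, d), (d, b)}) \<union> {(a, b), (b, a), (c, d), (d, c)}"
    unfolding S using d e e' by auto
  moreover have "distinct [a, c, b, d]" "(a, c) \<in> S" "(b, d) \<in> S" "(a, b) \<notin> S" "(c, d) \<notin> S"
    using d by (auto simp: S)
  ultimately show ?thesis unfolding switch_def by blast
qed

text \<open>Each of the four vertices trades one neighbour for another; all other neighbourhoods
  stay.\<close>

lemma switch_degree:
  assumes R: "simple R" and "switch R S"
  shows "card (S `` {x}) = card (R `` {x})"
proof -
  obtain a b c d where d: "distinct [a, b, c, d]"
    and e: "(a, b) \<in> R" "(c, d) \<in> R" "(a, c) \<notin> R" "(b, d) \<notin> R"
    and S: "S = (R - {(a, b), (b, a), (c, d), (d, c)}) \<union> {(a, c), (c, a), (b, d), (d, b)}"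
    using assms(2) unfolding switch_def by blast
  have e': "(b, a) \<in> R" "(d, c) \<in> R" "(c, a) \<notin> R" "(d, b) \<notin> R"
    using e simpleD(3)[OF R] by blast+
  have exchange: "card (insert z (R `` {x} - {y})) = card (R `` {x})"
    if "(x, y) \<in> R" "(x, z) \<notin> R" for y z
  proof -
    have "card (insert z (R `` {x} - {y})) = Suc (card (R `` {x} - {y}))"
      using that simpleD(5)[OF R] by (intro card_insert_disjoint) auto
    also have "\<dots> = card (R `` {x})"
      using that simpleD(5)[OF R] by (intro card_Suc_Diff1) auto
    finally show ?thesis .
  qed
  consider "x = a" | "x = b" | "x = c" | "x = d" | "x \<notin> {a, b, c, d}" by blast
  thus ?thesis
  proof cases
    case 1
    hence "S `` {x} = insert c (R `` {x} - {b})" using d by (auto simp: S)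
    thus ?thesis using exchange[of b c] e 1 by simp
  next
    case 2
    hence "S `` {x} = insert d (R `` {x} - {a})" using d by (auto simp: S)
    thus ?thesis using exchange[of a d] e e' 2 by simp
  next
    case 3
    hence "S `` {x} = insert a (R `` {x} - {d})" using d by (auto simp: S)
    thus ?thesis using exchange[of d a] e e' 3 by simp
  next
    case 4
    hence "S `` {x} = insert b (R `` {x} - {c})" using d by (auto simp: S)
    thus ?thesis using exchange[of c b] e e' 4 by simp
  next
    case 5
    hence "S `` {x} = R `` {x}" by (auto simp: S)
    thus ?thesis by simp
  qed
qed

lemma steps_refl: "steps P R R"
  by (simp add: steps_def)

lemma steps_single: "switch R S \<Longrightarrow> P S \<Longrightarrow> steps P R S"
  unfolding steps_def by blast

lemma steps_trans: "steps P R S \<Longrightarrow> steps P S T \<Longrightarrow> steps P R T"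
  unfolding steps_def by (rule rtranclp_trans)

lemma steps_simple_degree:
  assumes "steps P R S" "simple R"
  shows "simple S" "card (S `` {x}) = card (R `` {x})"
proof -
  from assms have "simple S \<and> card (S `` {x}) = card (R `` {x})"
    unfolding steps_def by (induction rule: rtranclp_induct) (auto simp: simple_switch switch_degree)
  thus "simple S" "card (S `` {x}) = card (R `` {x})" by simp_all
qed

lemma steps_last: "steps P R S \<Longrightarrow> P R \<Longrightarrow> P S"
  unfolding steps_def by (induction rule: rtranclp_induct) auto

text \<open>Reversal turns sources of switches into targets. These satisfy \<open>P\<close>: the
  first one by assumption, the others because they were targets already.\<close>

lemma steps_sym:
  assumes "steps P R S" "simple R" "P R"
  shows "steps P S R"
  using assms(1) unfolding steps_def
proof (induction rule: rtranclp_induct)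
  case (step S T)
  have RS: "steps P R S" using step by (simp add: steps_def)
  have "switch T S" using switch_sym step steps_simple_degree(1)[OF RS assms(2)] by blast
  moreover have "P S" using steps_last[OF RS assms(3)] .
  ultimately have "switch T S \<and> P S" by simp
  thus ?case using step.IH by (rule converse_rtranclp_into_rtranclp)
qed simp

section \<open>Deleting and reattaching a vertex\<close>

definition attach :: "'a \<Rightarrow> 'a set \<Rightarrow> 'a rel \<Rightarrow> 'a rel" where
  "attach v N R = R \<union> {v} \<times> N \<union> N \<times> {v}"

definition delete :: "'a \<Rightarrow> 'a rel \<Rightarrow> 'a rel" where
  "delete v R = {(x, y) \<in> R. x \<noteq> v \<and> y \<noteq> v}"

lemma attach_delete: "sym R \<Longrightarrow> attach v (R `` {v}) (delete v R) = R"
  by (auto simp: attach_def delete_def dest: symD)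

lemma simple_delete: "simple R \<Longrightarrow> simple (delete v R)"
  unfolding simple_def
  by (auto simp: delete_def sym_def irrefl_def intro: finite_subset[of _ R])

text \<open>As \<open>v\<close> is isolated, it is none of the four vertices of the switch, so the
  arcs added at \<open>v\<close> disturb none of the conditions.\<close>

lemma switch_attach:
  assumes R: "simple R" and v: "R `` {v} = {}" and "switch R S"
  shows "switch (attach v N R) (attach v N S)"
proof -
  obtain a b c d where d: "distinct [a, b, c, d]"
    and e: "(a, b) \<in> R" "(c, d) \<in> R" "(a, c) \<notin> R" "(b, d) \<notin> R"
    and S: "S = (R - {(a, b), (b, a), (c, d), (d, c)}) \<union> {(a, c), (c, a), (b, d), (d, b)}"
    using assms(3) unfolding switch_def by blast
  have "a \<noteq> v" "b \<noteq> v" "c \<noteq> v" "d \<noteq> v" using e v simpleD(3)[OF R] by blast+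
  thus ?thesis unfolding switch_def
    by (intro exI[of _ a] exI[of _ b] exI[of _ c] exI[of _ d]) (use d e in \<open>auto simp: S attach_def\<close>)
qed

text \<open>Switches preserve degrees, so \<open>v\<close> stays isolated along the whole sequence
  and each switch can be lifted.\<close>

lemma steps_attach:
  assumes "steps P R S" "simple R" "R `` {v} = {}"
    and PQ: "\<And>T. P T \<Longrightarrow> T `` {v} = {} \<Longrightarrow> simple T \<Longrightarrow> Q (attach v N T)"
  shows "steps Q (attach v N R) (attach v N S)"
  using assms(1) unfolding steps_def
proof (induction rule: rtranclp_induct)
  case (step S T)
  have "steps P R S" "steps P R T"
    using step by (auto simp: steps_def intro: rtranclp.rtrancl_into_rtrancl)
  note S = steps_simple_degree[OF this(1) assms(2)] and T = steps_simple_degree[OF this(2) assms(2)]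
  have "S `` {v} = {}" "T `` {v} = {}"
    using S(2)[of v] T(2)[of v] simpleD(5)[OF S(1)] simpleD(5)[OF T(1)] assms(3)
    by (metis card.empty card_0_eq)+
  hence "switch (attach v N S) (attach v N T) \<and> Q (attach v N T)"
    using step S T PQ by (simp add: switch_attach)
  with step.IH show ?case by (rule rtranclp.rtrancl_into_rtrancl)
qed simp

text \<open>The common induction step of both connectedness results. As \<open>v\<close> has the
  same neighbours in \<open>R\<close> and \<open>S\<close>, its deletion lowers the degrees of the
  same vertices; this discharges the premise of \<open>IH\<close>, and the resulting switches are
  lifted by reattaching \<open>v\<close>.\<close>

lemma steps_via_delete:
  assumes R: "simple R" and S: "simple S" and deg: "\<And>x. card (R `` {x}) = card (S `` {x})"
    and nb: "R `` {v} = S `` {v}"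
    and IH: "(\<And>x. card (delete v R `` {x}) = card (delete v S `` {x})) \<Longrightarrow>
       steps P (delete v R) (delete v S)"
    and PQ: "\<And>T. P T \<Longrightarrow> T `` {v} = {} \<Longrightarrow> simple T \<Longrightarrow> Q (attach v (S `` {v}) T)"
  shows "steps Q R S"
proof -
  have del: "delete v T `` {x} = (if x = v then {} else T `` {x} - {v})" for x and T :: "'a rel"
    by (auto simp: delete_def)
  have "card (delete v R `` {x}) = card (delete v S `` {x})" for x
  proof (cases "(x, v) \<in> R")
    case True
    hence "(x, v) \<in> S" using nb simpleD(3)[OF R] simpleD(3)[OF S] by blast
    with True show ?thesis using deg[of x] by (simp add: del card_Diff_singleton)
  next
    case False
    hence "(x, v) \<notin> S" using nb simpleD(3)[OF R] simpleD(3)[OF S] by blast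
    with False show ?thesis using deg[of x] by (simp add: del)
  qed
  hence "steps P (delete v R) (delete v S)" by (rule IH)
  hence "steps Q (attach v (S `` {v}) (delete v R)) (attach v (S `` {v}) (delete v S))"
    by (rule steps_attach) (use R PQ in \<open>auto simp: simple_delete del\<close>)
  thus ?thesis using attach_delete simpleD(2) R S nb by metis
qed

text \<open>The number of non-isolated vertices is the measure for both inductions.\<close>

lemma card_Domain_delete:
  assumes "simple R" "(v, u) \<in> R"
  shows "card (Domain (delete v R)) < card (Domain R)"
proof (rule psubset_card_mono)
  show "finite (Domain R)" using assms by (simp add: simple_def finite_Domain)
  show "Domain (delete v R) \<subset> Domain R" using assms by (auto simp: delete_def)
qed

lemma Domain_eq_degree: "simple R \<Longrightarrow> Domain R = {x. card (R `` {x}) \<noteq> 0}"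
  using simpleD(5)[of R] by auto

section \<open>Connectedness of the whole realization graph\<close>

text \<open>Since \<open>w\<close> has the neighbour \<open>v\<close> that \<open>u\<close> lacks,
  but no larger degree, \<open>u\<close> has a neighbour \<open>x\<close> that is neither
  \<open>w\<close> nor adjacent to \<open>w\<close>. The switch replaces \<open>vw\<close> and
  \<open>ux\<close> by \<open>vu\<close> and \<open>wx\<close>.\<close>

lemma exchange_neighbour:
  assumes R: "simple R" and w: "(v, w) \<in> R" and u: "(v, u) \<notin> R" "u \<noteq> v"
    and deg: "card (R `` {w}) \<le> card (R `` {u})"
  obtains R' where "switch R R'" "R' `` {v} = insert u (R `` {v} - {w})"
proof -
  have uw: "u \<noteq> w" "v \<noteq> w" "(w, v) \<in> R" "(u, v) \<notin> R" using u w simpleD(3,4)[OF R] by auto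
  have "\<exists>x. (u, x) \<in> R \<and> x \<noteq> w \<and> (w, x) \<notin> R"
  proof (rule ccontr)
    assume "\<not> ?thesis"
    \<comment> \<open>The inclusion is strict because of \<open>v\<close>. Removing \<open>w\<close>
      and \<open>u\<close> from these neighbourhoods costs each one vertex or none, according to
      whether \<open>u\<close> and \<open>w\<close> are adjacent.\<close>
    hence "R `` {u} - {w} \<subset> R `` {w} - {u}" using uw u simpleD(4)[OF R] by blast
    hence less: "card (R `` {u} - {w}) < card (R `` {w} - {u})"
      by (intro psubset_card_mono) (simp_all add: simpleD(5)[OF R])
    have "card (R `` {u}) < card (R `` {w})"
    proof (cases "u \<in> R `` {w}")
      case True
      hence "w \<in> R `` {u}" using simpleD(3)[OF R] by blast
      hence "card (R `` {u}) = Suc (card (R `` {u} - {w}))"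
        using simpleD(5)[OF R] by (metis card_Suc_Diff1)
      moreover have "card (R `` {w}) = Suc (card (R `` {w} - {u}))"
        using True simpleD(5)[OF R] by (metis card_Suc_Diff1)
      ultimately show ?thesis using less by simp
    next
      case False
      hence "w \<notin> R `` {u}" using simpleD(3)[OF R] by blast
      with False show ?thesis using less by simp
    qed
    thus False using deg by simp
  qed
  then obtain x where x: "(u, x) \<in> R" "x \<noteq> w" "(w, x) \<notin> R" by blast
  have d: "distinct [v, w, u, x]" using uw u x simpleD(4)[OF R] by auto
  let ?R = "(R - {(v, w), (w, v), (u, x), (x, u)}) \<union> {(v, u), (u, v), (w, x), (x, w)}"
  show ?thesis
  proof
    show "switch R ?R" unfolding switch_def using d w u x by blast
    show "?R `` {v} = insert u (R `` {v} - {w})" using d by auto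
  qed
qed

text \<open>Let \<open>w\<close> be a neighbour of \<open>v\<close> in \<open>R\<close> only and
  \<open>u\<close> one in \<open>S\<close> only. Degrees agree in \<open>R\<close> and
  \<open>S\<close>, so \<open>w\<close> can be exchanged for \<open>u\<close> in \<open>R\<close> or
  \<open>u\<close> for \<open>w\<close> in \<open>S\<close>, depending on which has the larger
  degree. Either exchange removes \<open>w\<close> from the difference of the
  neighbourhoods.\<close>

lemma align_neighbours:
  assumes "simple R" "simple S" "\<And>x. card (R `` {x}) = card (S `` {x})"
  shows "\<exists>R' S'. steps (\<lambda>_. True) R R' \<and> steps (\<lambda>_. True) S S' \<and> R' `` {v} = S' `` {v}"
  using assms
proof (induction "card (R `` {v} - S `` {v})" arbitrary: R S rule: less_induct)
  case less
  note R = less.prems(1) and S = less.prems(2) and deg = less.prems(3)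
  have fin: "finite (R `` {v})" "finite (S `` {v})" using simpleD(5) R S by blast+
  show ?case
  proof (cases "R `` {v} \<subseteq> S `` {v}")
    case True
    hence "R `` {v} = S `` {v}" using fin deg by (intro card_subset_eq) auto
    thus ?thesis using steps_refl by blast
  next
    case False
    then obtain w where w: "(v, w) \<in> R" "(v, w) \<notin> S" by blast
    have "\<not> S `` {v} \<subseteq> R `` {v}"
      using False fin deg[of v] by (metis card_subset_eq order_refl)
    then obtain u where u: "(v, u) \<in> S" "(v, u) \<notin> R" by blast
    have uv: "u \<noteq> v" "w \<noteq> v" using u w simpleD(4)[OF R] simpleD(4)[OF S] by blast+
    have smaller: "card (R `` {v} - S `` {v} - {w}) < card (R `` {v} - S `` {v})"
      using fin w by (intro card_Diff1_less) auto
    show ?thesis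
    proof (cases "card (R `` {w}) \<le> card (R `` {u})")
      case True
      obtain R' where R': "switch R R'" "R' `` {v} = insert u (R `` {v} - {w})"
        using exchange_neighbour[OF R w(1) u(2) uv(1) True] by blast
      have "R' `` {v} - S `` {v} = R `` {v} - S `` {v} - {w}" using R'(2) u by auto
      moreover have "simple R'" using simple_switch[OF R R'(1)] .
      moreover have "card (R' `` {x}) = card (S `` {x})" for x
        using switch_degree[OF R R'(1)] deg by simp
      ultimately obtain R'' S' where "steps (\<lambda>_. True) R' R''" "steps (\<lambda>_. True) S S'"
        "R'' `` {v} = S' `` {v}"
        using less.hyps[of R' S] smaller S by metis
      moreover have "steps (\<lambda>_. True) R R'" using R'(1) by (simp add: steps_single)
      ultimately show ?thesis using steps_trans by blast
    next
      case False
      hence "card (S `` {u}) \<le> card (S `` {w})" using deg by simp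
      then obtain S' where S': "switch S S'" "S' `` {v} = insert w (S `` {v} - {u})"
        using exchange_neighbour[OF S u(1) w(2) uv(2)] by blast
      have "R `` {v} - S' `` {v} = R `` {v} - S `` {v} - {w}" using S'(2) u by auto
      moreover have "simple S'" using simple_switch[OF S S'(1)] .
      moreover have "card (R `` {x}) = card (S' `` {x})" for x
        using switch_degree[OF S S'(1)] deg by simp
      ultimately obtain R' S'' where "steps (\<lambda>_. True) R R'" "steps (\<lambda>_. True) S' S''"
        "R' `` {v} = S'' `` {v}"
        using less.hyps[of R S'] smaller R by metis
      moreover have "steps (\<lambda>_. True) S S'" using S'(1) by (simp add: steps_single)
      ultimately show ?thesis using steps_trans by blast
    qed
  qed
qed

text \<open>Once the neighbourhoods of a non-isolated \<open>v\<close> are aligned, \<open>v\<close>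
  can be deleted; the sequence that altered \<open>S\<close> is finally run backwards.\<close>

lemma realizations_connected:
  assumes "simple R" "simple S" "\<And>x. card (R `` {x}) = card (S `` {x})"
  shows "steps (\<lambda>_. True) R S"
  using assms
proof (induction "card (Domain R)" arbitrary: R S rule: less_induct)
  case less
  note R = less.prems(1) and S = less.prems(2) and deg = less.prems(3)
  have dom: "Domain R = Domain S" by (simp add: Domain_eq_degree R S deg)
  show ?case
  proof (cases "R = {}")
    case True
    hence "S = {}" using dom by auto
    thus ?thesis using True steps_refl by blast
  next
    case False
    then obtain v u where vu: "(v, u) \<in> R" by auto
    obtain R' S' where RS: "steps (\<lambda>_. True) R R'" "steps (\<lambda>_. True) S S'" "R' `` {v} = S' `` {v}"
      using align_neighbours[OF R S deg] by blast
    note R' = steps_simple_degree[OF RS(1) R] and S' = steps_simple_degree[OF RS(2) S]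
    have "Domain R' = Domain R" by (simp add: Domain_eq_degree R R')
    hence "\<exists>u. (v, u) \<in> R'" using vu by blast
    hence small: "card (Domain (delete v R')) < card (Domain R)"
      using card_Domain_delete[OF R'(1)] \<open>Domain R' = Domain R\<close> by metis
    have "steps (\<lambda>_. True) R' S'"
    proof (rule steps_via_delete[OF R'(1) S'(1) _ RS(3)])
      show "card (R' `` {x}) = card (S' `` {x})" for x using deg R'(2) S'(2) by simp
      show "steps (\<lambda>_. True) (delete v R') (delete v S')"
        if "\<And>x. card (delete v R' `` {x}) = card (delete v S' `` {x})"
        using less.hyps[OF small simple_delete[OF R'(1)] simple_delete[OF S'(1)] that] .
    qed simp
    moreover have "steps (\<lambda>_. True) S' S" using steps_sym[OF RS(2) S] by simp
    ultimately show ?thesis using RS(1) steps_trans by blast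
  qed
qed

section \<open>Leaves and the induction for pseudoforests\<close>

text \<open>Every edge has the form \<open>{x, f x}\<close> with \<open>x\<close> non-isolated, so
  the non-isolated vertices have average degree at most 2. A degree of at least 3 must be balanced
  by a degree of 1.\<close>

lemma oriented_has_leaf:
  assumes R: "simple R" and f: "orients f R" and w: "3 \<le> card (R `` {w})"
  obtains v where "card (R `` {v}) = 1"
proof -
  let ?D = "Domain R"
  have fin: "finite ?D" using R by (simp add: simple_def finite_Domain)
  have "\<exists>v. card (R `` {v}) = 1"
  proof (rule ccontr)
    assume none: "\<nexists>v. card (R `` {v}) = 1"
    have ge2: "2 \<le> card (R `` {x})" if "x \<in> ?D" for x
    proof -
      have "card (R `` {x}) \<noteq> 0" using that Domain_eq_degree[OF R] by simp
      moreover have "card (R `` {x}) \<noteq> 1" using none by blast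
      ultimately show ?thesis by linarith
    qed
    have "w \<in> ?D" using w Domain_eq_degree[OF R] by simp
    hence "(\<Sum>x\<in>?D. 2) < (\<Sum>x\<in>?D. card (R `` {x}))"
      using fin ge2 w by (intro sum_strict_mono_ex1) (auto intro!: bexI[of _ w])
    also have "\<dots> = card (Sigma ?D (\<lambda>x. R `` {x}))"
      using fin simpleD(5)[OF R] by (simp add: card_SigmaI)
    also have "Sigma ?D (\<lambda>x. R `` {x}) = R" by auto
    \<comment> \<open>\<open>R\<close> contains both arcs of each edge, so \<open>card R\<close> is
      the sum of the degrees.\<close>
    finally have less: "2 * card ?D < card R" by simp
    have "R \<subseteq> (\<lambda>x. (x, f x)) ` ?D \<union> (\<lambda>x. (f x, x)) ` ?D"
    proof
      fix e assume "e \<in> R"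
      then obtain x y where xy: "e = (x, y)" "(x, y) \<in> R" "(y, x) \<in> R"
        using simpleD(3)[OF R] by (cases e) auto
      thus "e \<in> (\<lambda>x. (x, f x)) ` ?D \<union> (\<lambda>x. (f x, x)) ` ?D" using orientsD[OF f] by blast
    qed
    hence "card R \<le> card ((\<lambda>x. (x, f x)) ` ?D \<union> (\<lambda>x. (f x, x)) ` ?D)"
      using fin by (intro card_mono) auto
    also have "\<dots> \<le> card ((\<lambda>x. (x, f x)) ` ?D) + card ((\<lambda>x. (f x, x)) ` ?D)" by (rule card_Un_le)
    also have "\<dots> \<le> card ?D + card ?D" using fin by (intro add_mono card_image_le)
    finally show False using less by simp
  qed
  thus ?thesis using that by blast
qed

text \<open>
  At least two neighbours of \<open>w\<close> point to \<open>w\<close>, and one of them, \<open>x\<close>, is neither \<open>u\<close> nor adjacent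
  to \<open>u\<close>. The switch then only redirects the pointers of \<open>v\<close> and \<open>x\<close>.
\<close>

lemma move_leaf:
  assumes R: "simple R" and f: "orients f R" and v: "R `` {v} = {u}" and w: "3 \<le> card (R `` {w})"
  obtains R' where "steps (\<lambda>T. \<exists>f. orients f T) R R'" "R' `` {v} = {w}"
proof (cases "u = w")
  case True
  thus ?thesis using that steps_refl v by blast
next
  case False
  \<comment> \<open>The only edge at the leaf \<open>v\<close> can be assigned to \<open>v\<close>
    itself, so that its removal affects no pointer of \<open>u\<close>.\<close>
  define h where "h = f(v := u)"
  have vu: "(v, u) \<in> R" "(u, v) \<in> R" using v simpleD(3)[OF R] by blast+
  have vu': "y = u" if "(v, y) \<in> R \<or> (y, v) \<in> R" for y using that v simpleD(3)[OF R] by blast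
  have h: "h x = y \<or> h y = x" if "(x, y) \<in> R" for x y
    using orientsD[OF f that] that vu' by (auto simp: h_def)
  have "v \<noteq> w" using v w by auto
  define X where "X = {x \<in> R `` {w}. h x = w}"
  have finX: "finite X" by (rule finite_subset[OF _ simpleD(5)[OF R, of "{w}"]]) (auto simp: X_def)
  have "R `` {w} \<subseteq> insert (h w) X" using h by (auto simp: X_def)
  hence "card (R `` {w}) \<le> card (insert (h w) X)" using finX by (intro card_mono) auto
  also have "\<dots> \<le> Suc (card X)" using finX by (simp add: card_insert_if)
  finally have X2: "2 \<le> card X" using w by simp
  have "\<exists>x\<in>X. x \<noteq> u \<and> x \<noteq> h u"
  proof (rule ccontr)
    assume "\<not> ?thesis"
    hence "X \<subseteq> {u, h u}" by blast
    \<comment> \<open>If \<open>u\<close> is in \<open>X\<close>, then \<open>h u = w\<close>, which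
      is not in \<open>X\<close>; so at most one of the two excluded vertices lies in
      \<open>X\<close>.\<close>
    moreover have "w \<notin> X" using simpleD(4)[OF R] by (auto simp: X_def)
    hence "u \<notin> X \<or> h u \<notin> X" by (auto simp: X_def)
    ultimately have "X \<subseteq> {u} \<or> X \<subseteq> {h u}" by blast
    hence "card X \<le> 1" using card_mono[of "{u}" X] card_mono[of "{h u}" X] by auto
    thus False using X2 by simp
  qed
  then obtain x where x: "(w, x) \<in> R" "h x = w" "x \<noteq> u" "x \<noteq> h u" by (auto simp: X_def)
  have ux: "(u, x) \<notin> R" using h[of u x] x False by auto
  have "x \<noteq> v" using x(2) False by (auto simp: h_def)
  moreover have "x \<noteq> w" "u \<noteq> v" using x(1) vu simpleD(4)[OF R] by auto
  ultimately have d: "distinct [v, u, w, x]" using x(3) False \<open>v \<noteq> w\<close> by auto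
  define R' where "R' = (R - {(v, u), (u, v), (w, x), (x, w)}) \<union> {(v, w), (w, v), (u, x), (x, u)}"
  have sw: "switch R R'"
    unfolding switch_def R'_def using d vu x(1) ux vu' False by blast
  have "orients (h(v := w, x := u)) R'"
    unfolding orients_def
  proof (intro ballI, clarify)
    fix y z assume yz: "(y, z) \<in> R'" "(h(v := w, x := u)) z \<noteq> y"
    show "(h(v := w, x := u)) y = z"
    proof (cases "(y, z) \<in> R")
      case False
      thus ?thesis using yz d by (auto simp: R'_def)
    next
      case True
      hence "y \<noteq> v" "z \<noteq> v" using yz(1) d vu' by (auto simp: R'_def)
      thus ?thesis using h[OF True] yz x(2) d ux by (auto simp: R'_def split: if_splits)
    qed
  qed
  hence "steps (\<lambda>T. \<exists>f. orients f T) R R'" using sw by (auto intro: steps_single)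
  moreover have "R' `` {v} = {w}" using v d by (auto simp: R'_def)
  ultimately show ?thesis by (rule that)
qed

lemma oriented_realizations_connected:
  assumes "simple R" "simple S" "\<And>x. card (R `` {x}) = card (S `` {x})"
    and "orients f R" "orients g S"
  shows "steps (\<lambda>T. \<exists>f. orients f T) R S"
  using assms
proof (induction "card (Domain R)" arbitrary: R S f g rule: less_induct)
  case less
  note R = less.prems(1) and S = less.prems(2) and deg = less.prems(3)
    and f = less.prems(4) and g = less.prems(5)
  let ?P = "\<lambda>T. \<exists>f. orients f T"
  show ?case
  proof (cases "\<forall>x. card (R `` {x}) \<le> 2")
    case True
    \<comment> \<open>Degrees are invariant, so every relation on the way has maximum degree at most
      2 and can therefore be oriented.\<close>
    have "steps (\<lambda>_. True) R T \<Longrightarrow> steps ?P R T" for T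
      unfolding steps_def
    proof (induction rule: rtranclp_induct)
      case (step T U)
      hence "steps (\<lambda>_. True) R U" by (auto simp: steps_def intro: rtranclp.rtrancl_into_rtrancl)
      note U = steps_simple_degree[OF this R]
      have "one_cycle U"
        using U True by (intro degree_le_2_imp_one_cycle) (auto simp: simple_def)
      hence "?P U" using U(1) one_cycle_imp_orients unfolding simple_def by metis
      thus ?case using step by (auto intro: rtranclp.rtrancl_into_rtrancl)
    qed simp
    thus ?thesis using realizations_connected[OF R S deg] by blast
  next
    case False
    then obtain w where "\<not> card (R `` {w}) \<le> 2" by blast
    hence w: "3 \<le> card (R `` {w})" "3 \<le> card (S `` {w})" using deg by simp_all
    obtain v where v: "card (R `` {v}) = 1" using oriented_has_leaf[OF R f w(1)] by blast
    obtain u where u: "R `` {v} = {u}" using v card_1_singletonE by blast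
    obtain u' where u': "S `` {v} = {u'}" using v deg card_1_singletonE by metis
    obtain R' where R': "steps ?P R R'" "R' `` {v} = {w}"
      using move_leaf[OF R f u w(1)] by blast
    obtain S' where S': "steps ?P S S'" "S' `` {v} = {w}"
      using move_leaf[OF S g u' w(2)] by blast
    note sR' = steps_simple_degree[OF R'(1) R] and sS' = steps_simple_degree[OF S'(1) S]
    obtain f' where f': "orients f' R'" using steps_last[OF R'(1)] f by blast
    obtain g' where g': "orients g' S'" using steps_last[OF S'(1)] g by blast
    have del: "orients h (delete v T)" if "orients h T" for h and T :: "'a rel"
      using that by (auto simp: orients_def delete_def)
    have "(v, w) \<in> R'" using R'(2) by blast
    moreover have "Domain R' = Domain R" by (simp add: Domain_eq_degree R sR')
    ultimately have small: "card (Domain (delete v R')) < card (Domain R)"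
      using card_Domain_delete[OF sR'(1)] by metis
    have "steps ?P R' S'"
    proof (rule steps_via_delete[OF sR'(1) sS'(1)])
      show "card (R' `` {x}) = card (S' `` {x})" for x using deg sR'(2) sS'(2) by simp
      show "R' `` {v} = S' `` {v}" using R' S' by simp
      show "steps ?P (delete v R') (delete v S')"
        if "\<And>x. card (delete v R' `` {x}) = card (delete v S' `` {x})"
        using less.hyps[OF small simple_delete[OF sR'(1)] simple_delete[OF sS'(1)] that
            del[OF f'] del[OF g']] .
      show "?P (attach v (S' `` {v}) T)" if "?P T" "T `` {v} = {}" "simple T" for T
      proof -
        obtain h where "orients h T" using \<open>?P T\<close> by blast
        \<comment> \<open>The new edge is assigned to \<open>v\<close>, whose value is free because
          \<open>v\<close> is isolated in \<open>T\<close>.\<close>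
        hence "orients (h(v := w)) (attach v {w} T)"
          using that simpleD(3)[OF that(3)] unfolding orients_def attach_def by auto
        thus ?thesis using S'(2) by auto
      qed
    qed
    moreover have "steps ?P S' S" using steps_sym[OF S'(1) S] g by blast
    ultimately show ?thesis using R'(1) steps_trans by blast
  qed
qed

section \<open>Cycles and components of pair graphs\<close>

lemma pcas_nth:
  assumes "p \<noteq> []"
  shows "pcas u p v \<longleftrightarrow> fst (p ! 0) = u \<and> snd (last p) = v \<and>
    (\<forall>i. Suc i < length p \<longrightarrow> snd (p ! i) = fst (p ! Suc i))"
  using assms
proof (induction p arbitrary: u)
  case (Cons e p)
  show ?case
  proof (cases "p = []")
    case False
    have all: "(\<forall>i. Suc i < length (e # p) \<longrightarrow> snd ((e # p) ! i) = fst ((e # p) ! Suc i)) \<longleftrightarrow>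
      snd e = fst (p ! 0) \<and> (\<forall>i. Suc i < length p \<longrightarrow> snd (p ! i) = fst (p ! Suc i))" (is "?l \<longleftrightarrow> ?r")
    proof
      assume l: ?l
      have "snd (p ! i) = fst (p ! Suc i)" if "Suc i < length p" for i
        using l[rule_format, of "Suc i"] that by simp
      thus ?r using l[rule_format, of 0] False by simp
    next
      assume r: ?r
      show ?l
      proof (intro allI impI)
        fix i assume "Suc i < length (e # p)"
        thus "snd ((e # p) ! i) = fst ((e # p) ! Suc i)" using r by (cases i) auto
      qed
    qed
    show ?thesis unfolding all using Cons.IH[OF False, of "snd e"] False by auto
  qed auto
qed simp

lemma pawalk_verts_pcas: "pcas u p v \<Longrightarrow> pawalk_verts u p = u # map snd p"
  by (induction p arbitrary: u) auto

text \<open>The heads of the arcs are the vertices of the walk after its first one, which is why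
  distinctness concerns \<open>map snd p\<close>.\<close>

lemma cycle_with_proj_iff:
  assumes "parcs K \<subseteq> pverts K \<times> pverts K"
  shows "pre_digraph.cycle (with_proj K) p \<longleftrightarrow> p \<noteq> [] \<and> set p \<subseteq> parcs K \<and>
    distinct (map snd p) \<and> snd (last p) = fst (p ! 0) \<and>
    (\<forall>i. Suc i < length p \<longrightarrow> snd (p ! i) = fst (p ! Suc i))"
proof (cases "p = []")
  case False
  have "fst (p ! 0) \<in> pverts K" if "set p \<subseteq> parcs K"
    using that False assms nth_mem[of 0 p] by fastforce
  thus ?thesis using False
    unfolding pre_digraph.cycle_def pre_digraph.awalk_def cas_with_proj_eq
      awalk_verts_with_proj_eq with_proj_simps
    by (auto simp: pcas_nth pawalk_verts_pcas)
qed (simp add: pre_digraph.cycle_def)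

lemma cycles_with_proj:
  assumes "parcs K \<subseteq> pverts K \<times> pverts K"
  shows "cycles (with_proj K) = {cycle_edges g | k g. cycle_in (parcs K) k g}"
proof
  show "cycles (with_proj K) \<subseteq> {cycle_edges g | k g. cycle_in (parcs K) k g}"
  proof
    fix C assume "C \<in> cycles (with_proj K)"
    then obtain p where C: "C = (\<lambda>e. {fst e, snd e}) ` set p"
      and cyc: "pre_digraph.cycle (with_proj K) p" and len: "3 \<le> length p"
      unfolding cycles_def by auto
    note p = cyc[unfolded cycle_with_proj_iff[OF assms]]
    define k where "k = length p"
    \<comment> \<open>Distinctness is known for heads, so \<open>g i\<close> is the head of arc
      \<open>i\<close>; it is then arc \<open>i + 1\<close> that joins \<open>g i\<close> to
      \<open>g (Suc i)\<close>.\<close>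
    define g where "g i = snd (p ! (i mod k))" for i
    have k: "3 \<le> k" using len by (simp add: k_def)
    have edge: "(g i, g (Suc i)) = p ! (Suc i mod k)" for i
    proof -
      have "i mod k < k" using k by simp
      have "snd (p ! (i mod k)) = fst (p ! (Suc i mod k))"
      proof (cases "Suc (i mod k) = k")
        case True
        hence "length p - 1 = i mod k" by (simp add: k_def)
        hence "last p = p ! (i mod k)" using p by (simp add: last_conv_nth)
        thus ?thesis using True p by (simp add: mod_Suc)
      next
        case False
        hence "Suc (i mod k) < length p" using \<open>i mod k < k\<close> by (simp add: k_def)
        thus ?thesis using p False by (simp add: mod_Suc)
      qed
      thus ?thesis by (simp add: g_def)
    qed
    have edge_in: "(g i, g (Suc i)) \<in> set p" for i
    proof -
      have "Suc i mod k < k" using k by simp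
      thus ?thesis using nth_mem[of "Suc i mod k" p] edge[of i] by (simp add: k_def)
    qed
    have "cycle_in (parcs K) k g"
      unfolding cycle_in_def
    proof (intro conjI allI)
      show "3 \<le> k" by (rule k)
      show "inj_on g {..<k}"
        using p by (auto simp: inj_on_def g_def k_def distinct_conv_nth)
      show "g (i + k) = g i" for i by (simp add: g_def)
      show "(g i, g (Suc i)) \<in> parcs K" for i using p edge_in by blast
    qed
    moreover have "C = cycle_edges g"
    proof
      show "C \<subseteq> cycle_edges g"
      proof
        fix c assume "c \<in> C"
        then obtain j where j: "j < k" "c = {fst (p ! j), snd (p ! j)}"
          unfolding C by (auto simp: in_set_conv_nth k_def)
        have "Suc (j + k - 1) mod k = j" using j k by simp
        hence "c = {g (j + k - 1), g (Suc (j + k - 1))}" using j edge[of "j + k - 1"]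
          by (metis fst_conv snd_conv)
        thus "c \<in> cycle_edges g" unfolding cycle_edges_def by blast
      qed
      show "cycle_edges g \<subseteq> C"
      proof
        fix c assume "c \<in> cycle_edges g"
        then obtain i where c: "c = {g i, g (Suc i)}" by (auto simp: cycle_edges_def)
        have "(g i, g (Suc i)) \<in> set p" by (rule edge_in)
        thus "c \<in> C" unfolding C c by force
      qed
    qed
    ultimately show "C \<in> {cycle_edges g | k g. cycle_in (parcs K) k g}" by blast
  qed
  show "{cycle_edges g | k g. cycle_in (parcs K) k g} \<subseteq> cycles (with_proj K)"
  proof
    fix C assume "C \<in> {cycle_edges g | k g. cycle_in (parcs K) k g}"
    then obtain k g where C: "C = cycle_edges g" and cyc: "cycle_in (parcs K) k g" by blast
    note g = cyc[unfolded cycle_in_def]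
    \<comment> \<open>Arc \<open>i\<close> has head \<open>g i\<close>, and its tail is the
      preceding vertex; the summand \<open>k\<close> avoids truncation at
      \<open>i = 0\<close>.\<close>
    define p where "p = map (\<lambda>i. (g (i + k - 1), g i)) [0..<k]"
    have k: "3 \<le> k" and len: "length p = k" using g by (auto simp: p_def)
    have nth: "p ! i = (g (i + k - 1), g i)" if "i < k" for i using that by (simp add: p_def)
    have "pre_digraph.cycle (with_proj K) p"
      unfolding cycle_with_proj_iff[OF assms]
    proof (intro conjI allI impI)
      show "p \<noteq> []" using k len by auto
      show "set p \<subseteq> parcs K"
      proof
        fix e assume "e \<in> set p"
        then obtain i where i: "i < k" "e = (g (i + k - 1), g i)" by (auto simp: p_def)
        have "g i = g (Suc (i + k - 1))" using g k by simp
        thus "e \<in> parcs K" using i g by metis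
      qed
      show "distinct (map snd p)"
        using g by (simp add: p_def comp_def distinct_map atLeast0LessThan)
      show "snd (last p) = fst (p ! 0)"
        using k nth[of 0] nth[of "k - 1"] len \<open>p \<noteq> []\<close> by (simp add: last_conv_nth)
      show "snd (p ! i) = fst (p ! Suc i)" if "Suc i < length p" for i
        using that g k by (simp add: len nth)
    qed
    moreover have "(\<lambda>e. {fst e, snd e}) ` set p = C"
    proof
      show "(\<lambda>e. {fst e, snd e}) ` set p \<subseteq> C"
      proof
        fix c assume "c \<in> (\<lambda>e. {fst e, snd e}) ` set p"
        then obtain i where "c = {g (i + k - 1), g i}" by (auto simp: p_def)
        hence "c = {g (i + k - 1), g (Suc (i + k - 1))}" using g k by simp
        thus "c \<in> C" unfolding C cycle_edges_def by blast
      qed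
      show "C \<subseteq> (\<lambda>e. {fst e, snd e}) ` set p"
      proof
        fix c assume "c \<in> C"
        then obtain i where c: "c = {g i, g (Suc i)}" by (auto simp: C cycle_edges_def)
        let ?j = "Suc i mod k"
        have "?j < k" using k by simp
        hence "(g (?j + k - 1), g ?j) \<in> set p" using nth_mem[of ?j p] nth[of ?j] len by simp
        moreover have "g ?j = g (Suc i)" by (rule cycle_in_mod[OF cyc])
        moreover have "g (?j + k - 1) = g i"
        proof -
          have "(?j + k - 1) mod k = i mod k"
            using k by (cases "Suc (i mod k) = k") (auto simp: mod_Suc)
          thus ?thesis using cycle_in_eq_iff[OF cyc] by blast
        qed
        ultimately show "c \<in> (\<lambda>e. {fst e, snd e}) ` set p"
          unfolding c by (intro image_eqI[of _ _ "(g (?j + k - 1), g ?j)"]) simp_all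
      qed
    qed
    ultimately show "C \<in> cycles (with_proj K)" using k len by (auto simp: cycles_def)
  qed
qed

section \<open>Components and the two characterizations of pseudoforests\<close>

lemma pair_graph_iff:
  "pair_graph G \<longleftrightarrow> finite (pverts G) \<and> parcs G \<subseteq> pverts G \<times> pverts G \<and> simple (parcs G)"
proof
  assume "pair_graph G"
  then interpret pair_graph G .
  have "sym (parcs G)" using pair_sym_arcs by (simp add: symmetric_def)
  moreover have "irrefl (parcs G)" using pair_no_loops by (force simp: irrefl_def)
  ultimately show "finite (pverts G) \<and> parcs G \<subseteq> pverts G \<times> pverts G \<and> simple (parcs G)"
    using pair_finite_verts pair_finite_arcs in_arcsD1 in_arcsD2 by (auto simp: simple_def)
next
  assume "finite (pverts G) \<and> parcs G \<subseteq> pverts G \<times> pverts G \<and> simple (parcs G)"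
  thus "pair_graph G"
    by unfold_locales (auto simp: simple_def irrefl_def symmetric_def)
qed

lemma reachable_with_proj_iff:
  assumes "pair_graph G"
  shows "u \<rightarrow>\<^sup>*\<^bsub>with_proj G\<^esub> v \<longleftrightarrow> u \<in> pverts G \<and> (u, v) \<in> (parcs G)\<^sup>*"
proof
  interpret pair_graph G by fact
  assume "u \<rightarrow>\<^sup>*\<^bsub>with_proj G\<^esub> v"
  thus "u \<in> pverts G \<and> (u, v) \<in> (parcs G)\<^sup>*"
    using reachable_rtranclI[of "with_proj G"] reachable_in_vertsE[of "with_proj G"]
    by (metis with_proj_simps(1,3))
next
  interpret pair_graph G by fact
  assume "u \<in> pverts G \<and> (u, v) \<in> (parcs G)\<^sup>*"
  hence "(u, v) \<in> (parcs G)\<^sup>*" "u \<in> pverts G" by auto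
  thus "u \<rightarrow>\<^sup>*\<^bsub>with_proj G\<^esub> v"
  proof (induction rule: rtrancl_induct)
    case (step y z)
    thus ?case unfolding reachable_def by (auto intro: rtrancl_on_into_rtrancl_on in_arcsD2)
  qed (simp add: reachable_def)
qed

text \<open>Cycles with connected starting vertices lie in the same component, so
  \<open>one_cycle\<close> says that each component has at most one cycle: with none it is a tree,
  with one it is unicyclic.\<close>

lemma pseudoforest_iff_one_cycle:
  "pseudoforest G \<longleftrightarrow> pair_graph G \<and> one_cycle (parcs G)"
proof
  assume pf: "pseudoforest G"
  hence pg: "pair_graph G" by (simp add: pseudoforest_def)
  then interpret pair_graph G .
  let ?R = "parcs G"
  have "one_cycle ?R"
    unfolding one_cycle_def
  proof (intro allI impI)
    fix k g l h assume g: "cycle_in ?R k g" and h: "cycle_in ?R l h" and gh: "(g 0, h 0) \<in> ?R\<^sup>*"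
    \<comment> \<open>The component that contains both cycles.\<close>
    define V where "V = {v. g 0 \<rightarrow>\<^sup>*\<^bsub>with_proj G\<^esub> v}"
    define K where "K = \<lparr>pverts = V, parcs = {e \<in> ?R. fst e \<in> V \<and> snd e \<in> V}\<rparr>"
    have "(g 0, g (Suc 0)) \<in> ?R" using g unfolding cycle_in_def by blast
    hence g0: "g 0 \<in> pverts G" by (rule in_arcsD1)
    have "with_proj G \<restriction> V = with_proj K"
      by (simp add: induce_subgraph_def with_proj_def K_def)
    hence "with_proj K \<in> pre_digraph.sccs (with_proj G)"
      using induce_reachable_is_in_sccs[OF g0] by (simp add: V_def)
    hence uni: "is_tree (with_proj K) \<or> unicyclic (with_proj K)"
      using pf by (simp add: pseudoforest_def)
    have V: "v \<in> V \<longleftrightarrow> (g 0, v) \<in> ?R\<^sup>*" for v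
      using g0 by (simp add: V_def reachable_with_proj_iff[OF pg])
    have "g i \<in> V" for i using cycle_in_connected[OF g, of 0 i] by (simp add: V)
    hence gK: "cycle_in (parcs K) k g" using g by (simp add: cycle_in_def K_def)
    have "h i \<in> V" for i
      using cycle_in_connected[OF h, of 0 i] gh unfolding V by (simp add: rtrancl_trans[of "g 0" "h 0"])
    hence hK: "cycle_in (parcs K) l h" using h by (simp add: cycle_in_def K_def)
    have "parcs K \<subseteq> pverts K \<times> pverts K" by (auto simp: K_def)
    note cycles_with_proj[OF this]
    hence "cycle_edges g \<in> cycles (with_proj K)" "cycle_edges h \<in> cycles (with_proj K)"
      using gK hK by blast+
    thus "cycle_edges g = cycle_edges h" using uni unfolding is_tree_def unicyclic_def by blast
  qed
  with pg show "pair_graph G \<and> one_cycle ?R" by simp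
next
  assume asm: "pair_graph G \<and> one_cycle (parcs G)"
  hence pg: "pair_graph G" by simp
  then interpret pair_graph G .
  let ?R = "parcs G"
  have "is_tree H \<or> unicyclic H" if "H \<in> pre_digraph.sccs (with_proj G)" for H
  proof -
    have ind: "induced_subgraph H (with_proj G)" and sc: "strongly_connected H"
      using that by (auto simp: pre_digraph.sccs_def)
    \<comment> \<open>A component comes as a general digraph; it is repackaged as a pair digraph so
      that \<open>cycles_with_proj\<close> applies.\<close>
    define K where "K = \<lparr>pverts = verts H, parcs = arcs H\<rparr>"
    have H: "H = with_proj K"
      using ind by (cases H)
        (simp add: K_def with_proj_def induced_subgraph_def subgraph_def compatible_def)
    have sub: "parcs K \<subseteq> ?R" "parcs K \<subseteq> pverts K \<times> pverts K"
      using ind by (auto simp: H induced_subgraph_def subgraph_def)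
    have conn: "connected H"
      unfolding connected_conv
    proof (intro conjI ballI)
      show "verts H \<noteq> {}" using sc by (simp add: strongly_connected_def)
      fix u v assume "u \<in> verts H" "v \<in> verts H"
      hence "(u, v) \<in> rtrancl_on (verts H) (arcs_ends H)"
        using sc by (simp add: strongly_connected_def reachable_def)
      thus "(u, v) \<in> rtrancl_on (verts H) ((arcs_ends H)\<^sup>s)"
        by (rule rtrancl_on_mono[rotated 2]) (auto simp: symcl_def)
    qed
    have "cycle_edges g = cycle_edges h"
      if g: "cycle_in (parcs K) k g" and h: "cycle_in (parcs K) l h" for k g l h
    proof -
      have gh: "cycle_in ?R k g" "cycle_in ?R l h" using g h sub by (auto simp: cycle_in_def)
      have "(g 0, g (Suc 0)) \<in> parcs K" "(h 0, h (Suc 0)) \<in> parcs K"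
        using g h unfolding cycle_in_def by blast+
      hence "g 0 \<in> verts H" "h 0 \<in> verts H" using sub by (auto simp: H)
      hence "g 0 \<rightarrow>\<^sup>*\<^bsub>H\<^esub> h 0" using sc by (simp add: strongly_connected_def)
      hence "(g 0, h 0) \<in> (parcs K)\<^sup>*" using reachable_rtranclI by (fastforce simp: H)
      hence "(g 0, h 0) \<in> ?R\<^sup>*" using rtrancl_mono[OF sub(1)] by blast
      thus ?thesis using asm gh unfolding one_cycle_def by blast
    qed
    hence "C = C'" if "C \<in> cycles H" "C' \<in> cycles H" for C C'
      using that unfolding H cycles_with_proj[OF sub(2)] by blast
    thus ?thesis using conn unfolding is_tree_def unicyclic_def by blast
  qed
  thus "pseudoforest G" using pg by (simp add: pseudoforest_def)
qed

lemma pseudoforest_iff_orients: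
  "pseudoforest G \<longleftrightarrow> pair_graph G \<and> (\<exists>f. orients f (parcs G))"
proof -
  have "one_cycle (parcs G) \<longleftrightarrow> (\<exists>f. orients f (parcs G))" if "pair_graph G"
  proof
    assume "one_cycle (parcs G)"
    moreover have "sym (parcs G)" "irrefl (parcs G)"
      using that by (simp_all add: pair_graph_iff simple_def)
    ultimately obtain f where "orients f (parcs G)" using one_cycle_imp_orients by blast
    thus "\<exists>f. orients f (parcs G)" by blast
  qed (auto intro: orients_imp_one_cycle)
  thus ?thesis unfolding pseudoforest_iff_one_cycle by blast
qed

section \<open>Transfer from arc relations to the realization graph\<close>

lemma two_switch_iff:
  "two_switch G H \<longleftrightarrow> pverts H = pverts G \<and> switch (parcs G) (parcs H)"
  unfolding two_switch_def switch_def by (cases H) auto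

lemma out_degree_with_proj: "out_degree (with_proj G) v = card (parcs G `` {v})"
proof -
  have "out_arcs (with_proj G) v = Pair v ` (parcs G `` {v})" by (auto simp: out_arcs_def)
  thus ?thesis by (simp add: out_degree_def card_image inj_on_def)
qed

lemma realizations_two_switch:
  assumes "G \<in> realizations n d" "two_switch G H" "pseudoforest H"
  shows "H \<in> realizations n d"
  using assms switch_degree[of "parcs G" "parcs H"]
  by (simp add: realizations_def two_switch_iff pair_graph_iff pseudoforest_def out_degree_with_proj)

lemma pseudoforests_linked:
  assumes G: "G \<in> realizations n d" "pseudoforest G" and H: "H \<in> realizations n d" "pseudoforest H"
  shows "(\<lambda>G' H'. two_switch G' H' \<and> pseudoforest H')\<^sup>*\<^sup>* G H"
proof -
  let ?V = "{1..n}"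
  have g: "simple (parcs G)" "parcs G \<subseteq> ?V \<times> ?V" "pverts G = ?V"
    and h: "simple (parcs H)" "parcs H \<subseteq> ?V \<times> ?V" "pverts H = ?V"
    using G H by (auto simp: realizations_def pair_graph_iff)
  have "card (parcs G `` {x}) = card (parcs H `` {x})" for x
  proof (cases "x \<in> ?V")
    case True
    thus ?thesis using G H by (simp add: realizations_def out_degree_with_proj)
  next
    case False
    hence "parcs G `` {x} = {}" "parcs H `` {x} = {}" using g h by auto
    thus ?thesis by simp
  qed
  moreover obtain f f' where "orients f (parcs G)" "orients f' (parcs H)"
    using G H by (auto simp: pseudoforest_iff_orients)
  ultimately have "steps (\<lambda>T. \<exists>f. orients f T) (parcs G) (parcs H)"
    using oriented_realizations_connected[OF g(1) h(1)] by blast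
  moreover have "(\<lambda>G' H'. two_switch G' H' \<and> pseudoforest H')\<^sup>*\<^sup>* G \<lparr>pverts = ?V, parcs = T\<rparr>"
    if "steps (\<lambda>T. \<exists>f. orients f T) (parcs G) T" for T
    using that unfolding steps_def
  proof (induction rule: rtranclp_induct)
    case base
    have "\<lparr>pverts = ?V, parcs = parcs G\<rparr> = G" using g by (cases G) simp
    thus ?case by simp
  next
    case (step T U)
    have "steps (\<lambda>T. \<exists>f. orients f T) (parcs G) U"
      using step by (auto simp: steps_def intro: rtranclp.rtrancl_into_rtrancl)
    note U = steps_simple_degree[OF this g(1)]
    \<comment> \<open>Degrees are invariant, so no vertex outside \<open>{1..n}\<close> ever
      receives an edge.\<close>
    have "Domain U = Domain (parcs G)" by (simp add: Domain_eq_degree U g)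
    hence "Domain U \<subseteq> ?V" using g by auto
    hence "U \<subseteq> ?V \<times> ?V" using simpleD(3)[OF U(1)] by (auto simp: subset_iff Domain_iff)
    hence "pseudoforest \<lparr>pverts = ?V, parcs = U\<rparr>"
      using U step by (simp add: pseudoforest_iff_orients pair_graph_iff)
    moreover have "two_switch \<lparr>pverts = ?V, parcs = T\<rparr> \<lparr>pverts = ?V, parcs = U\<rparr>"
      using step by (simp add: two_switch_iff)
    ultimately show ?case using step.IH by (auto intro: rtranclp.rtrancl_into_rtrancl)
  qed
  moreover have "\<lparr>pverts = ?V, parcs = parcs H\<rparr> = H" using h by (cases H) simp
  ultimately show ?thesis by fastforce
qed

theorem mainTheorem3:
  fixes n :: nat and d :: "nat \<Rightarrow> nat"
  assumes "degree_sequence n d"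
  shows "(verts (pseudoforest_graph n d) \<noteq> {} \<longrightarrow> connected (pseudoforest_graph n d)) \<and>
    (\<forall>G \<in> realizations n d. \<forall>H \<in> realizations n d. pseudoforest G \<longrightarrow> pseudoforest H \<longrightarrow>
      (\<lambda>G' H'. two_switch G' H' \<and> pseudoforest H')\<^sup>*\<^sup>* G H)"
proof (intro conjI impI ballI)
  fix G H assume "G \<in> realizations n d" "H \<in> realizations n d" "pseudoforest G" "pseudoforest H"
  thus "(\<lambda>G' H'. two_switch G' H' \<and> pseudoforest H')\<^sup>*\<^sup>* G H" by (intro pseudoforests_linked)
next
  let ?P = "pseudoforest_graph n d"
  have verts: "verts ?P = {G \<in> realizations n d. pseudoforest G}"
    by (simp add: pseudoforest_graph_def)
  assume ne: "verts ?P \<noteq> {}"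
  show "connected ?P"
    unfolding connected_conv
  proof (intro conjI ballI)
    fix G H assume G: "G \<in> verts ?P" and H: "H \<in> verts ?P"
    have "(\<lambda>G' H'. two_switch G' H' \<and> pseudoforest H')\<^sup>*\<^sup>* G H"
      using G H by (intro pseudoforests_linked) (auto simp: verts)
    \<comment> \<open>Membership in \<open>verts ?P\<close> is carried along: it yields that the
      next graph is again a realization, as \<open>rtrancl_on\<close> demands.\<close>
    hence "(G, H) \<in> rtrancl_on (verts ?P) ((arcs_ends ?P)\<^sup>s) \<and> H \<in> verts ?P"
    proof (induction rule: rtranclp_induct)
      case (step K L)
      hence "L \<in> verts ?P" using realizations_two_switch[of K n d L] by (simp add: verts)
      moreover have "(K, L) \<in> arcs_ends ?P"
        using step \<open>L \<in> verts ?P\<close> unfolding arcs_ends_conv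
        by (auto simp: pseudoforest_graph_def realization_graph_def induce_subgraph_def image_iff)
      hence "(K, L) \<in> (arcs_ends ?P)\<^sup>s" by (simp add: symcl_def)
      ultimately show ?case using step.IH by (auto intro: rtrancl_on_into_rtrancl_on)
    qed (use G in simp)
    thus "(G, H) \<in> rtrancl_on (verts ?P) ((arcs_ends ?P)\<^sup>s)" by simp
  qed (use ne in simp)
qed

end
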